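(* Let $t\ge 2$ and $k\ge 1$ be given integers. Then ${\rm forb}(m,t\cdot F_{0,k,k,0})$ is $\Theta(m^k)$ as $m\to\infty$.
   Context: A matrix is simple if it is a (0,1)-matrix with no repeated columns. For (0,1)-matrices $F$ and $A$, $F$ is a configuration in $A$, written $F\prec A$, if some row and column permutation of $F$ is a submatrix of $A$. For a finite family $\mathcal F$ of (0,1)-matrices (not necessarily simple), ${\rm forb}(m,\mathcal F)$ is the maximum number of columns of an $m$-rowed simple matrix $A$ with $F\not\prec A$ for all $F\in\mathcal F$; for a single matrix, ${\rm forb}(m,F)={\rm forb}(m,\{F\})$. For a matrix $M$, $t\cdot M=[M\,|\,M\,|\cdots|\,M]$ is the concatenation of $t$ copies of $M$. $F_{e,f,g,h}$ denotes the $(e+f+g+h)\times 2$ (0,1)-matrix with $e$ rows $[1\,1]$, $f$ rows $[1\,0]$, $g$ rows $[0\,1]$ and $h$ rows $[0\,0]$. The asymptotics are in $m$ with $t,k$ fixed. *)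

theory Defs
  imports
    "HOL-Combinatorics.Permutations"
    "HOL-Library.Landau_Symbols"
    "Jordan_Normal_Form.Matrix"
    "Jordan_Normal_Form.DL_Submatrix"
begin

definition zero_one_mat :: "nat mat \<Rightarrow> bool" where
  "zero_one_mat A \<longleftrightarrow> elements_mat A \<subseteq> {0, 1}"

definition simple_mat :: "nat mat \<Rightarrow> bool" where
  "simple_mat A \<longleftrightarrow> zero_one_mat A \<and> distinct (cols A)"

definition configuration_in :: "nat mat \<Rightarrow> nat mat \<Rightarrow> bool" where
  "configuration_in F A \<longleftrightarrow>
     (\<exists>p q I J. p permutes {..<dim_row F} \<and> q permutes {..<dim_col F} \<and>
        I \<subseteq> {..<dim_row A} \<and> J \<subseteq> {..<dim_col A} \<and>
        mat (dim_row F) (dim_col F) (\<lambda>(i, j). F $$ (p i, q j)) = submatrix A I J)"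

definition forb_col_counts :: "nat \<Rightarrow> nat mat set \<Rightarrow> nat set" where
  "forb_col_counts m \<F> =
     {dim_col A | A. simple_mat A \<and> dim_row A = m \<and> (\<forall>F\<in>\<F>. \<not> configuration_in F A)}"

definition forb :: "nat \<Rightarrow> nat mat set \<Rightarrow> nat" where
  "forb m \<F> = Max (forb_col_counts m \<F>)"

definition repeat_mat :: "nat \<Rightarrow> nat mat \<Rightarrow> nat mat" where
  "repeat_mat t M = mat (dim_row M) (t * dim_col M) (\<lambda>(i, j). M $$ (i, j mod dim_col M))"

definition F_mat :: "nat \<Rightarrow> nat \<Rightarrow> nat \<Rightarrow> nat \<Rightarrow> nat mat" where
  "F_mat e f g h = mat_of_rows_list 2
     (replicate e [1, 1] @ replicate f [1, 0] @ replicate g [0, 1] @ replicate h [0, 0])"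

text \<open>The maximum in \<open>forb\<close> is over a finite set, which is nonempty as soon as every
  forbidden matrix has a column.\<close>

lemma simple_mat_dim_col_le:
  assumes "simple_mat A"
  shows "dim_col A \<le> 2 ^ dim_row A"
proof -
  let ?f = "\<lambda>v :: nat vec. {i. i < dim_row A \<and> v $ i = 1}"
  have entries: "v $ i \<in> {0, 1}" if "v \<in> set (cols A)" "i < dim_row A" for v i
  proof -
    obtain j where "j < dim_col A" "v = col A j"
      using \<open>v \<in> set (cols A)\<close> by (auto simp: cols_def)
    moreover have "A $$ (i, j) \<in> elements_mat A"
      using that \<open>j < dim_col A\<close> by auto
    ultimately show ?thesis
      using assms that by (auto simp: simple_mat_def zero_one_mat_def)
  qed
  have dims: "dim_vec v = dim_row A" if "v \<in> set (cols A)" for v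
    using that by (auto simp: cols_def)
  have "inj_on ?f (set (cols A))"
  proof (rule inj_onI)
    fix v w assume vw: "v \<in> set (cols A)" "w \<in> set (cols A)" and eq: "?f v = ?f w"
    show "v = w"
    proof (rule eq_vecI)
      fix i assume "i < dim_vec w"
      then have "i < dim_row A" using dims vw by simp
      moreover from this have "v $ i = 1 \<longleftrightarrow> w $ i = 1" using eq by blast
      ultimately show "v $ i = w $ i" using entries[OF vw(1)] entries[OF vw(2)] by fastforce
    qed (use dims vw in simp)
  qed
  moreover have "?f ` set (cols A) \<subseteq> Pow {..<dim_row A}" by auto
  ultimately have "card (set (cols A)) \<le> card (Pow {..<dim_row A})"
    by (intro card_inj_on_le[of ?f]) auto
  moreover have "card (set (cols A)) = dim_col A"
    using assms by (simp add: simple_mat_def distinct_card)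
  ultimately show ?thesis by (simp add: card_Pow)
qed

lemma finite_forb_col_counts: "finite (forb_col_counts m \<F>)"
  by (rule finite_subset[of _ "{..2 ^ m}"])
     (use simple_mat_dim_col_le in \<open>auto simp: forb_col_counts_def\<close>)

lemma forb_col_counts_nonempty:
  assumes "\<And>F. F \<in> \<F> \<Longrightarrow> dim_col F > 0"
  shows "forb_col_counts m \<F> \<noteq> {}"
proof -
  let ?A = "0\<^sub>m m 0 :: nat mat"
  have "simple_mat ?A"
    by (auto simp: simple_mat_def zero_one_mat_def cols_def elements_mat_def)
  moreover have "\<not> configuration_in F ?A" if "F \<in> \<F>" for F
  proof
    assume "configuration_in F ?A"
    then obtain p q I J where
      "mat (dim_row F) (dim_col F) (\<lambda>(i, j). F $$ (p i, q j)) = submatrix ?A I J"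
      unfolding configuration_in_def by blast
    then have "dim_col F = dim_col (submatrix ?A I J)"
      by (metis dim_col_mat(1))
    then show False using assms[OF that] by (simp add: dim_submatrix)
  qed
  ultimately have "dim_col ?A \<in> forb_col_counts m \<F>"
    unfolding forb_col_counts_def using index_zero_mat(2) by blast
  then show ?thesis by blast
qed

end

theory Submission
  imports Defs
begin

text \<open>
  Identify the columns of a simple matrix with a family \<open>\<F>\<close> of subsets of \<open>{..<m}\<close>. The
  configuration is a pair of disjoint \<open>k\<close>-sets \<open>S\<close>, \<open>T\<close> such that at least \<open>t\<close> members contain \<open>S\<close>
  and avoid \<open>T\<close>, and at least \<open>t\<close> contain \<open>T\<close> and avoid \<open>S\<close>.

  For the upper bound, arrange \<open>\<F>\<close> as a binary tree of traces on \<open>{..<i}\<close>. Walking down to a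
  member, the last trace with at least \<open>2t\<close> extensions has two nonempty children, one of them with
  at least \<open>t\<close> extensions. The traces \<open>\<E>\<close> of this kind on a fixed level satisfy two conditions:
  there are no \<open>A\<close>, \<open>B\<close> in \<open>\<E>\<close> with \<open>|A - B|\<close> and \<open>|B - A|\<close> both at least \<open>k\<close>, and (up to
  complementation) if \<open>|S| = k - 1\<close>, \<open>|T| = k\<close> and some member contains \<open>T\<close> and avoids \<open>S\<close>, then
  fewer than \<open>t\<close> members contain \<open>S\<close> and avoid \<open>T\<close>. Split \<open>\<E>\<close> into layers of sets of equal size.
  A layer has at most as many members as it shatters sets (Pajor), it shatters no \<open>k\<close>-set, and each
  \<open>(k-1)\<close>-set is shattered by boundedly many layers. So \<open>|\<E>| = O(m^(k-1))\<close>, and summing over the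
  \<open>m\<close> levels gives \<open>O(m^k)\<close>.
\<close>

section \<open>Shattering and layers\<close>

definition sep :: "'a set set \<Rightarrow> 'a set \<Rightarrow> 'a set \<Rightarrow> 'a set set" where
  "sep \<F> S T = {A \<in> \<F>. S \<subseteq> A \<and> A \<inter> T = {}}"

definition shatters :: "'a set set \<Rightarrow> 'a set \<Rightarrow> bool" where
  "shatters \<F> Y \<longleftrightarrow> (\<forall>Z\<subseteq>Y. \<exists>A\<in>\<F>. A \<inter> Y = Z)"

lemma shatters_mono:
  assumes "shatters \<F> Y" "\<F> \<subseteq> \<G>"
  shows "shatters \<G> Y"
  unfolding shatters_def
proof (intro allI impI)
  fix Z assume "Z \<subseteq> Y"
  then obtain A where "A \<in> \<F>" "A \<inter> Y = Z" using assms(1) by (auto simp: shatters_def)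
  then show "\<exists>A\<in>\<G>. A \<inter> Y = Z" using assms(2) by auto
qed

lemma shatters_subset:
  assumes "shatters \<F> Y" "\<F> \<subseteq> Pow X"
  shows "Y \<subseteq> X"
proof -
  obtain A where "A \<in> \<F>" "A \<inter> Y = Y" using assms(1) by (auto simp: shatters_def)
  then show ?thesis using assms(2) by auto
qed

text \<open>Pajor's inequality, by induction on the ground set. Split at \<open>x\<close> into the
  members without \<open>x\<close> and the members with \<open>x\<close>, from which
  \<open>x\<close> is deleted. A set shattered by one half is shattered by the whole family, and a
  set shattered by both halves stays shattered after adding \<open>x\<close>.\<close>

lemma card_le_card_shattered:
  assumes "finite X" "\<F> \<subseteq> Pow X"
  shows "card \<F> \<le> card {Y. shatters \<F> Y}"
  using assms
proof (induction X arbitrary: \<F> rule: finite_induct)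
  case empty
  then consider "\<F> = {}" | "\<F> = {{}}" by auto
  then show ?case
  proof cases
    case 2
    have "{Y. shatters \<F> Y} = {{}}" unfolding 2 shatters_def by auto
    then show ?thesis by (simp add: 2)
  qed simp
next
  case (insert x X)
  define \<F>0 where "\<F>0 = {A \<in> \<F>. x \<notin> A}"
  define \<F>1 where "\<F>1 = (\<lambda>A. A - {x}) ` {A \<in> \<F>. x \<in> A}"
  define S0 where "S0 = {Y. shatters \<F>0 Y}"
  define S1 where "S1 = {Y. shatters \<F>1 Y}"
  have sub: "\<F>0 \<subseteq> Pow X" "\<F>1 \<subseteq> Pow X"
    using insert.prems by (auto simp: \<F>0_def \<F>1_def)
  have fin: "finite \<F>" using insert.prems insert.hyps(1) by (meson finite.insertI finite_Pow_iff finite_subset)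
  have S01: "S0 \<subseteq> Pow X" "S1 \<subseteq> Pow X"
    using shatters_subset sub by (auto simp: S0_def S1_def; blast)+
  then have finS: "finite S0" "finite S1"
    using insert.hyps(1) by (meson finite_Pow_iff finite_subset)+
  have in1: "\<exists>A\<in>\<F>. A \<inter> Y = Z" if Y: "shatters \<F>1 Y" "Y \<subseteq> X" "Z \<subseteq> Y" for Y Z
  proof -
    obtain B where "B \<in> \<F>1" "B \<inter> Y = Z"
      using Y unfolding shatters_def by blast
    then obtain A where "A \<in> \<F>" "x \<in> A" "(A - {x}) \<inter> Y = Z"
      unfolding \<F>1_def by auto
    then show ?thesis using Y insert.hyps(2) by (intro bexI[of _ A]) auto
  qed
  have both: "shatters \<F> (insert x Y)" if Y: "shatters \<F>0 Y" "shatters \<F>1 Y" "Y \<subseteq> X" for Y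
    unfolding shatters_def
  proof (intro allI impI)
    fix Z assume Z: "Z \<subseteq> insert x Y"
    show "\<exists>A\<in>\<F>. A \<inter> insert x Y = Z"
    proof (cases "x \<in> Z")
      case True
      have "Z - {x} \<subseteq> Y" using Z by auto
      then obtain B where "B \<in> \<F>1" "B \<inter> Y = Z - {x}"
        using Y(2) unfolding shatters_def by blast
      then obtain A where "A \<in> \<F>" "x \<in> A" "(A - {x}) \<inter> Y = Z - {x}"
        unfolding \<F>1_def by auto
      then show ?thesis using True Y(3) insert.hyps(2) by (intro bexI[of _ A]) auto
    next
      case False
      then have "Z \<subseteq> Y" using Z by auto
      then obtain A where "A \<in> \<F>0" "A \<inter> Y = Z"
        using Y(1) unfolding shatters_def by blast
      then show ?thesis unfolding \<F>0_def by (intro bexI[of _ A]) auto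
    qed
  qed
  have "S0 \<union> S1 \<union> insert x ` (S0 \<inter> S1) \<subseteq> {Y. shatters \<F> Y}"
  proof -
    have "S0 \<subseteq> {Y. shatters \<F> Y}"
      using shatters_mono[of \<F>0 _ \<F>] by (auto simp: S0_def \<F>0_def)
    moreover have "S1 \<subseteq> {Y. shatters \<F> Y}"
      using in1 S01 by (auto simp: S1_def shatters_def[of \<F>])
    moreover have "insert x ` (S0 \<inter> S1) \<subseteq> {Y. shatters \<F> Y}"
      using both S01 by (auto simp: S0_def S1_def)
    ultimately show ?thesis by blast
  qed
  moreover have "{Y. shatters \<F> Y} \<subseteq> Pow (insert x X)"
    using insert.prems by (blast dest: shatters_subset)
  then have "finite {Y. shatters \<F> Y}"
    by (rule finite_subset) (use insert.hyps(1) in simp)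
  ultimately have le: "card (S0 \<union> S1 \<union> insert x ` (S0 \<inter> S1)) \<le> card {Y. shatters \<F> Y}"
    by (rule card_mono[rotated])
  \<comment> \<open>Sets in the image contain \<open>x\<close>, the others do not. The image
    therefore makes up exactly for the sets that the union of \<open>S0\<close> and
    \<open>S1\<close> counts only once.\<close>
  have "card (S0 \<union> S1 \<union> insert x ` (S0 \<inter> S1)) = card (S0 \<union> S1) + card (insert x ` (S0 \<inter> S1))"
    using S01 finS insert.hyps(2) by (intro card_Un_disjoint) auto
  also have "card (insert x ` (S0 \<inter> S1)) = card (S0 \<inter> S1)"
    using S01 insert.hyps(2) by (intro card_image inj_onI) (metis Int_iff PowD insert_ident subsetD)
  also have "card (S0 \<union> S1) + card (S0 \<inter> S1) = card S0 + card S1"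
    using card_Un_Int[OF finS] by simp
  finally have "card S0 + card S1 \<le> card {Y. shatters \<F> Y}" using le by simp
  moreover have "card \<F>0 \<le> card S0" "card \<F>1 \<le> card S1"
    using insert.IH sub by (auto simp: S0_def S1_def)
  moreover have "card \<F>1 = card {A \<in> \<F>. x \<in> A}"
    unfolding \<F>1_def by (intro card_image inj_onI) auto
  moreover have "card \<F> = card \<F>0 + card {A \<in> \<F>. x \<in> A}"
    unfolding \<F>0_def using fin by (subst card_Un_disjoint[symmetric]) (auto intro!: arg_cong[of _ _ card])
  ultimately show ?case by simp
qed

text \<open>Let \<open>B\<close> avoid \<open>S\<close> in the highest layer shattering \<open>S\<close>. A set \<open>A \<supseteq> S\<close> from a lower
  layer satisfies \<open>A - B = S\<close>, and all these \<open>A\<close> miss at least \<open>k\<close> points of one fixed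
  \<open>(2k-1)\<close>-subset \<open>R\<close> of \<open>B\<close>; now pigeonhole over the \<open>k\<close>-subsets of \<open>R\<close>.\<close>

lemma card_shattering_layers_le:
  fixes \<E> :: "'a set set"
  assumes X: "finite X" "\<E> \<subseteq> Pow X" and k: "k \<ge> 1"
    and cross: "\<And>A B. A \<in> \<E> \<Longrightarrow> B \<in> \<E> \<Longrightarrow> card (A - B) < k \<or> card (B - A) < k"
    and light: "\<And>S T. card S = k - 1 \<Longrightarrow> card T = k \<Longrightarrow> sep \<E> T S \<noteq> {} \<Longrightarrow> card (sep \<E> S T) < t"
    and S: "finite S" "card S = k - 1"
  shows "card {a. shatters {A \<in> \<E>. card A = a} S} \<le> t * 2 ^ (2 * k - 1) + k" (is "card ?L \<le> _")
proof (cases "?L = {}")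
  case False
  have finE: "finite A" if "A \<in> \<E>" for A using that X finite_subset by blast
  have fin\<E>: "finite \<E>" using X by (meson finite_Pow_iff finite_subset)
  \<comment> \<open>For sets with \<open>card A \<le> card B\<close> the difference
    \<open>A - B\<close> is the smaller one, so the disjunction in \<open>cross\<close> always
    yields a bound on it.\<close>
  have diff: "card (A - B) < k" if "A \<in> \<E>" "B \<in> \<E>" "card A \<le> card B" for A B
  proof -
    have "card (A - B) \<le> card (B - A)"
      using that finE by (simp add: card_le_sym_Diff)
    then show ?thesis using cross[OF that(1,2)] by linarith
  qed
  have up: "\<exists>A\<in>\<E>. card A = a \<and> S \<subseteq> A" if "a \<in> ?L" for a
    using that unfolding shatters_def by blast
  have "?L \<subseteq> card ` \<E>" using up by auto
  then have finL: "finite ?L" using fin\<E> finite_surj by blast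
  define b where "b = Max ?L"
  have "b \<in> ?L" unfolding b_def using finL False by (rule Max_in)
  then obtain B where B: "B \<in> \<E>" "card B = b" "B \<inter> S = {}"
    unfolding shatters_def by blast
  \<comment> \<open>The top \<open>k\<close> possible sizes are set aside and counted trivially at
    the end. The gap of \<open>k\<close> below \<open>b\<close> is what makes room for
    \<open>R\<close>.\<close>
  define L' where "L' = {a \<in> ?L. a + k \<le> b}"
  obtain f where f: "\<And>a. a \<in> ?L \<Longrightarrow> f a \<in> \<E> \<and> card (f a) = a \<and> S \<subseteq> f a"
    using bchoice[of ?L "\<lambda>a A. A \<in> \<E> \<and> card A = a \<and> S \<subseteq> A"] up by blast
  have fB: "f a - B = S" if "a \<in> ?L" for a
  proof -
    have "S \<subseteq> f a - B" using f[OF that] B by blast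
    moreover have "card (f a - B) < k"
      using diff[of "f a" B] f[OF that] B Max_ge[OF finL that] b_def by simp
    then have "card (f a - B) \<le> card S" using S by simp
    moreover have "finite (f a - B)" using f[OF that] finE by simp
    ultimately show ?thesis using card_seteq by metis
  qed
  have "card L' \<le> t * 2 ^ (2 * k - 1)"
  proof (cases "L' = {}")
    case ne: False
    have finL': "finite L'" using finL by (simp add: L'_def)
    define a0 where "a0 = Max L'"
    have a0: "a0 \<in> ?L" "a0 + k \<le> b"
      using Max_in[OF finL' ne] by (auto simp: L'_def a0_def)
    have "card (f a0) + card (B - f a0) = card B + card (f a0 - B)"
    proof -
      have "finite (f a0)" "finite B" using f[OF a0(1)] B finE by auto
      then have "card (f a0) = card (f a0 \<inter> B) + card (f a0 - B)"
        "card B = card (f a0 \<inter> B) + card (B - f a0)"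
        by (metis card_Int_Diff, metis card_Int_Diff Int_commute)
      then show ?thesis by simp
    qed
    \<comment> \<open>The size of \<open>R\<close> comes from here:
      \<open>card (B - f a0) = (b - a0) + card S\<close>, with \<open>b - a0 \<ge> k\<close> and
      \<open>card S = k - 1\<close>.\<close>
    then have "2 * k - 1 \<le> card (B - f a0)"
      using fB[OF a0(1)] f[OF a0(1)] B(2) S(2) a0(2) k by simp
    then obtain R where R: "R \<subseteq> B - f a0" "card R = 2 * k - 1" "finite R"
      by (meson obtain_subset_with_card_n)
    define \<T> where "\<T> = {T. T \<subseteq> R \<and> card T = k}"
    have fin\<T>: "finite \<T>" using R(3) by (simp add: \<T>_def)
    have cov: "f ` L' \<subseteq> (\<Union>T\<in>\<T>. sep \<E> S T)"
    proof
      fix A assume "A \<in> f ` L'"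
      then obtain a where a: "a \<in> L'" "A = f a" by blast
      have aL: "a \<in> ?L" using a by (simp add: L'_def)
      \<comment> \<open>Since \<open>a0\<close> is the largest size in \<open>L'\<close>,
        \<open>f a\<close> is no larger than \<open>f a0\<close> and gains fewer than
        \<open>k\<close> points over it. As \<open>R\<close> avoids \<open>f a0\<close>, at most
        \<open>k - 1\<close> of its \<open>2 * k - 1\<close> points lie in \<open>A\<close>.\<close>
      have "card (f a - f a0) < k"
        using diff[of "f a" "f a0"] f[OF aL] f[OF a0(1)] Max_ge[OF finL' a(1)] a0_def by simp
      moreover have "R \<inter> A \<subseteq> f a - f a0" using R a by auto
      moreover have "finite (f a - f a0)" using f[OF aL] finE by simp
      ultimately have "card (R \<inter> A) < k" by (meson card_mono le_less_trans)
      moreover have "card R = card (R \<inter> A) + card (R - A)" using R(3) by (metis card_Int_Diff)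
      ultimately have "k \<le> card (R - A)" using R(2) by simp
      then obtain T where T: "T \<subseteq> R - A" "card T = k" by (meson obtain_subset_with_card_n)
      then have "A \<in> sep \<E> S T" using f[OF aL] a by (auto simp: sep_def)
      moreover have "T \<in> \<T>" using T by (auto simp: \<T>_def)
      ultimately show "A \<in> (\<Union>T\<in>\<T>. sep \<E> S T)" by blast
    qed
    have fins: "finite (sep \<E> S T)" for T using fin\<E> by (simp add: sep_def)
    have "inj_on f L'" using f by (intro inj_onI) (metis (mono_tags, lifting) L'_def mem_Collect_eq)
    then have "card L' = card (f ` L')" by (simp add: card_image)
    also have "\<dots> \<le> card (\<Union>T\<in>\<T>. sep \<E> S T)"
      using cov fins fin\<T> by (intro card_mono) auto
    also have "\<dots> \<le> (\<Sum>T\<in>\<T>. card (sep \<E> S T))" by (rule card_UN_le[OF fin\<T>])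
    also have "\<dots> \<le> (\<Sum>T\<in>\<T>. t)"
    proof (rule sum_mono)
      fix T assume "T \<in> \<T>"
      \<comment> \<open>\<open>B\<close> contains \<open>R\<close>, hence \<open>T\<close>, and
        avoids \<open>S\<close>: it is the witness that makes \<open>light\<close>
        applicable.\<close>
      then have "B \<in> sep \<E> T S" using B R by (auto simp: sep_def \<T>_def)
      then show "card (sep \<E> S T) \<le> t"
        using light[OF S(2), of T] \<open>T \<in> \<T>\<close> by (force simp: \<T>_def)
    qed
    also have "\<dots> = card \<T> * t" by simp
    also have "\<dots> \<le> card (Pow R) * t"
      using R(3) by (intro mult_right_mono card_mono) (auto simp: \<T>_def)
    finally show ?thesis using R by (simp add: card_Pow mult.commute)
  qed simp
  moreover have "?L \<subseteq> L' \<union> {b + 1 - k..b}"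
    using Max_ge[OF finL] by (auto simp: L'_def b_def)
  then have "card ?L \<le> card (L' \<union> {b + 1 - k..b})"
    using finL by (intro card_mono) (auto simp: L'_def)
  moreover have "card (L' \<union> {b + 1 - k..b}) \<le> card L' + card {b + 1 - k..b}"
    by (rule card_Un_le)
  moreover have "card {b + 1 - k..b} \<le> k" by simp
  ultimately show ?thesis by linarith
qed simp

text \<open>A set with at most \<open>j\<close> elements is built by \<open>j\<close> choices, each
  an element of \<open>X\<close> or nothing. The option type in the induction step encodes one such
  choice, with \<open>Suc (card X)\<close> outcomes.\<close>

lemma card_subsets_less_le:
  assumes "finite X"
  shows "card {Y. Y \<subseteq> X \<and> card Y < Suc j} \<le> Suc (card X) ^ j"
proof (induction j)
  case 0
  have "{Y. Y \<subseteq> X \<and> card Y < Suc 0} \<subseteq> {{}}"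
    using assms finite_subset by fastforce
  then show ?case using card_mono[of "{{}}" "{Y. Y \<subseteq> X \<and> card Y < Suc 0}"] by simp
next
  case (Suc j)
  let ?A = "{Y. Y \<subseteq> X \<and> card Y < Suc j}"
  let ?g = "\<lambda>(Y, x). case x of None \<Rightarrow> Y | Some x \<Rightarrow> insert x Y"
  let ?D = "?A \<times> insert None (Some ` X)"
  have "{Y. Y \<subseteq> X \<and> card Y < Suc (Suc j)} \<subseteq> ?g ` ?D"
  proof
    fix Y assume Y: "Y \<in> {Y. Y \<subseteq> X \<and> card Y < Suc (Suc j)}"
    show "Y \<in> ?g ` ?D"
    proof (cases "Y = {}")
      case True
      then show ?thesis by (intro image_eqI[of _ _ "({}, None)"]) auto
    next
      case False
      then obtain x where "x \<in> Y" by blast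
      moreover have "finite Y" using Y assms finite_subset by blast
      ultimately show ?thesis using Y
        by (intro image_eqI[of _ _ "(Y - {x}, Some x)"]) (auto simp: insert_absorb)
    qed
  qed
  moreover have "finite ?D" using assms by simp
  ultimately have "card {Y. Y \<subseteq> X \<and> card Y < Suc (Suc j)} \<le> card ?D"
    by (meson card_image_le card_mono finite_imageI le_trans)
  also have "\<dots> = card ?A * Suc (card X)"
    using assms by (simp add: card_cartesian_product card_image card_insert_if)
  also have "\<dots> \<le> Suc (card X) ^ j * Suc (card X)"
    using Suc.IH by (rule mult_right_mono) simp
  finally show ?case by (simp add: mult.commute)
qed

text \<open>Pajor's inequality is summed over the layers. Shattered sets have at most
  \<open>k - 1\<close> elements. Those with exactly \<open>k - 1\<close> are double counted through
  \<open>card_shattering_layers_le\<close>; the smaller ones are fewer by a factor of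
  \<open>Suc (card X)\<close>, which pays for counting them anew in every layer.\<close>

lemma card_le_of_cross_light:
  fixes \<E> :: "'a set set"
  assumes X: "finite X" "\<E> \<subseteq> Pow X" and k: "k \<ge> 1"
    and cross: "\<And>A B. A \<in> \<E> \<Longrightarrow> B \<in> \<E> \<Longrightarrow> card (A - B) < k \<or> card (B - A) < k"
    and light: "\<And>S T. card S = k - 1 \<Longrightarrow> card T = k \<Longrightarrow> sep \<E> T S \<noteq> {} \<Longrightarrow> card (sep \<E> S T) < t"
  shows "card \<E> \<le> (t * 2 ^ (2 * k - 1) + k + 1) * Suc (card X) ^ (k - 1)"
proof -
  let ?n = "card X"
  define \<L> where "\<L> a = {A \<in> \<E>. card A = a}" for a
  define \<Y> where "\<Y> = {Y. Y \<subseteq> X \<and> card Y = k - 1}"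
  define \<Z> where "\<Z> = {Y. Y \<subseteq> X \<and> card Y < k - 1}"
  have fin: "finite \<Y>" "finite \<Z>" using X by (auto simp: \<Y>_def \<Z>_def)
  have finE: "finite A" if "A \<in> \<E>" for A using that X finite_subset by blast
  have L: "\<L> a \<subseteq> Pow X" for a using X by (auto simp: \<L>_def)
  have sh: "{Y. shatters (\<L> a) Y} \<subseteq> {Y \<in> \<Y>. shatters (\<L> a) Y} \<union> \<Z>" for a
  proof
    fix Y assume "Y \<in> {Y. shatters (\<L> a) Y}"
    then have Y: "shatters (\<L> a) Y" by simp
    obtain A where A: "A \<in> \<E>" "card A = a" "A \<inter> Y = Y"
      using Y unfolding shatters_def \<L>_def by blast
    obtain B where B: "B \<in> \<E>" "card B = a" "B \<inter> Y = {}"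
      using Y unfolding shatters_def \<L>_def by blast
    \<comment> \<open>\<open>A\<close> realises the full trace on \<open>Y\<close> and
      \<open>B\<close> the empty one, so \<open>Y\<close> lies in \<open>A - B\<close>. Within a
      layer both differences have the same size, and \<open>cross\<close> makes it less than
      \<open>k\<close>.\<close>
    have "card (A - B) = card (B - A)"
      using A B finE by (intro card_le_sym_Diff antisym) auto
    then have "card (A - B) < k" using cross A B by metis
    moreover have "card Y \<le> card (A - B)" using A B finE by (intro card_mono) auto
    ultimately have "card Y \<le> k - 1" using k by simp
    then show "Y \<in> {Y \<in> \<Y>. shatters (\<L> a) Y} \<union> \<Z>"
      using Y shatters_subset[OF Y L] by (auto simp: \<Y>_def \<Z>_def)
  qed
  have "card \<E> = card (\<Union>a\<le>?n. \<L> a)"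
    using X by (intro arg_cong[of _ _ card]) (auto simp: \<L>_def card_mono)
  also have "\<dots> \<le> (\<Sum>a\<le>?n. card (\<L> a))" by (rule card_UN_le) simp
  also have "\<dots> \<le> (\<Sum>a\<le>?n. card {Y \<in> \<Y>. shatters (\<L> a) Y} + card \<Z>)"
  proof (rule sum_mono)
    fix a
    have "card (\<L> a) \<le> card {Y. shatters (\<L> a) Y}" by (rule card_le_card_shattered[OF X(1) L])
    also have "\<dots> \<le> card ({Y \<in> \<Y>. shatters (\<L> a) Y} \<union> \<Z>)"
      using sh fin by (intro card_mono) auto
    also have "\<dots> \<le> card {Y \<in> \<Y>. shatters (\<L> a) Y} + card \<Z>" by (rule card_Un_le)
    finally show "card (\<L> a) \<le> card {Y \<in> \<Y>. shatters (\<L> a) Y} + card \<Z>" .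
  qed
  also have "\<dots> = (\<Sum>a\<le>?n. card {Y \<in> \<Y>. shatters (\<L> a) Y}) + Suc ?n * card \<Z>"
    by (simp add: sum.distrib)
  \<comment> \<open>Double counting: instead of shattered sets per layer, count layers per
    \<open>(k-1)\<close>-set.\<close>
  also have "(\<Sum>a\<le>?n. card {Y \<in> \<Y>. shatters (\<L> a) Y}) = (\<Sum>Y\<in>\<Y>. card {a \<in> {..?n}. shatters (\<L> a) Y})"
    using sum.swap_restrict[of "{..?n}" \<Y> "\<lambda>_ _. 1::nat" "\<lambda>a Y. shatters (\<L> a) Y"] fin by simp
  also have "\<dots> \<le> (\<Sum>Y\<in>\<Y>. t * 2 ^ (2 * k - 1) + k)"
  proof (rule sum_mono)
    fix Y assume Y: "Y \<in> \<Y>"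
    then have finY: "finite Y" "card Y = k - 1" using X finite_subset by (auto simp: \<Y>_def)
    have "{a. shatters (\<L> a) Y} \<subseteq> {..?n}"
    proof
      fix a assume "a \<in> {a. shatters (\<L> a) Y}"
      then obtain A where "A \<in> \<L> a" unfolding shatters_def by blast
      then show "a \<in> {..?n}" using X by (auto simp: \<L>_def card_mono)
    qed
    then have "{a \<in> {..?n}. shatters (\<L> a) Y} = {a. shatters {A \<in> \<E>. card A = a} Y}"
      by (auto simp: \<L>_def)
    then show "card {a \<in> {..?n}. shatters (\<L> a) Y} \<le> t * 2 ^ (2 * k - 1) + k"
      using card_shattering_layers_le[OF X k cross light finY] by simp
  qed
  also have "\<dots> = (t * 2 ^ (2 * k - 1) + k) * card \<Y>" by simp
  finally have "card \<E> \<le> (t * 2 ^ (2 * k - 1) + k) * card \<Y> + Suc ?n * card \<Z>" by simp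
  moreover have "card \<Y> \<le> card {Y. Y \<subseteq> X \<and> card Y < Suc (k - 1)}"
    using X(1) by (intro card_mono) (auto simp: \<Y>_def)
  then have "card \<Y> \<le> Suc ?n ^ (k - 1)"
    using card_subsets_less_le[OF X(1), of "k - 1"] by linarith
  then have "(t * 2 ^ (2 * k - 1) + k) * card \<Y> \<le> (t * 2 ^ (2 * k - 1) + k) * Suc ?n ^ (k - 1)"
    by (rule mult_left_mono) simp
  \<comment> \<open>For \<open>k = 1\<close> no set is counted by \<open>\<Z>\<close>; otherwise the
    exponent \<open>j\<close> is \<open>k - 2\<close>.\<close>
  moreover have "Suc ?n * card \<Z> \<le> Suc ?n ^ (k - 1)"
  proof (cases "k - 1")
    case (Suc j)
    have "Suc ?n * card \<Z> \<le> Suc ?n * Suc ?n ^ j"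
      using card_subsets_less_le[OF X(1), of j] Suc by (intro mult_left_mono) (auto simp: \<Z>_def)
    then show ?thesis unfolding Suc power_Suc .
  qed (simp add: \<Z>_def)
  ultimately show ?thesis unfolding add_mult_distrib[of _ 1] by linarith
qed

section \<open>The tree of traces\<close>

text \<open>Disjointness of \<open>S\<close> and \<open>T\<close> is implicit: for
  \<open>t \<ge> 1\<close> some member contains \<open>S\<close> and avoids
  \<open>T\<close>.\<close>

definition crossing :: "nat \<Rightarrow> nat \<Rightarrow> 'a set set \<Rightarrow> bool" where
  "crossing t k \<F> \<longleftrightarrow>
     (\<exists>S T. card S = k \<and> card T = k \<and> t \<le> card (sep \<F> S T) \<and> t \<le> card (sep \<F> T S))"

definition with_trace :: "nat set set \<Rightarrow> nat \<Rightarrow> nat set \<Rightarrow> nat set set" where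
  "with_trace \<F> i P = {A \<in> \<F>. A \<inter> {..<i} = P}"

text \<open>Forks of the tree at level \<open>i\<close>. The digit names the child that is merely
  nonempty (1: members containing \<open>i\<close>); the opposite child is heavy, with at least
  \<open>t\<close> members. Complementation exchanges \<open>branch1\<close> and
  \<open>branch0\<close>.\<close>

definition branch1 :: "nat \<Rightarrow> nat set set \<Rightarrow> nat \<Rightarrow> nat set set" where
  "branch1 t \<F> i =
     {P. P \<subseteq> {..<i} \<and> t \<le> card (with_trace \<F> (Suc i) P) \<and> with_trace \<F> (Suc i) (insert i P) \<noteq> {}}"

definition branch0 :: "nat \<Rightarrow> nat set set \<Rightarrow> nat \<Rightarrow> nat set set" where
  "branch0 t \<F> i =
     {P. P \<subseteq> {..<i} \<and> t \<le> card (with_trace \<F> (Suc i) (insert i P)) \<and> with_trace \<F> (Suc i) P \<noteq> {}}"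

lemma with_trace_subset_sep:
  assumes "S \<subseteq> P" "T \<inter> P = {}" "T \<subseteq> {..<i}"
  shows "with_trace \<F> i P \<subseteq> sep \<F> S T"
  using assms unfolding with_trace_def sep_def by auto

text \<open>Both conditions of \<open>card_le_of_cross_light\<close> hold for the forks. For
  \<open>cross\<close>, the heavy children of \<open>A\<close> and \<open>B\<close> supply the two
  groups of \<open>t\<close> members. For \<open>light\<close>, the point \<open>i\<close> is the
  missing \<open>k\<close>-th element: a violation would make \<open>insert i S\<close> and
  \<open>T\<close> a crossing pair.\<close>

lemma card_branch1_le:
  fixes \<F> :: "nat set set"
  assumes fin: "finite \<F>" and free: "\<not> crossing t k \<F>" and t: "t \<ge> 1" and k: "k \<ge> 1"
  shows "card (branch1 t \<F> i) \<le> (t * 2 ^ (2 * k - 1) + k + 1) * Suc i ^ (k - 1)"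
proof -
  let ?E = "branch1 t \<F> i"
  have fin_sep: "finite (sep \<F> S T)" for S T using fin by (simp add: sep_def)
  have sub: "?E \<subseteq> Pow {..<i}" by (auto simp: branch1_def)
  have cross: "card (A - B) < k \<or> card (B - A) < k" if AB: "A \<in> ?E" "B \<in> ?E" for A B
  proof (rule ccontr)
    assume "\<not> ?thesis"
    then have "k \<le> card (A - B)" "k \<le> card (B - A)" by auto
    then obtain S T where S: "S \<subseteq> A - B" "card S = k" and T: "T \<subseteq> B - A" "card T = k"
      by (metis obtain_subset_with_card_n)
    have "S \<subseteq> {..<Suc i}" "T \<subseteq> {..<Suc i}" using S T AB sub by force+
    then have "with_trace \<F> (Suc i) A \<subseteq> sep \<F> S T" "with_trace \<F> (Suc i) B \<subseteq> sep \<F> T S"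
      using S T by (intro with_trace_subset_sep; auto)+
    then have "card (with_trace \<F> (Suc i) A) \<le> card (sep \<F> S T)" "card (with_trace \<F> (Suc i) B) \<le> card (sep \<F> T S)"
      by (simp_all add: card_mono fin_sep)
    moreover have "t \<le> card (with_trace \<F> (Suc i) A)" "t \<le> card (with_trace \<F> (Suc i) B)"
      using AB by (auto simp: branch1_def)
    ultimately have "crossing t k \<F>" unfolding crossing_def using S T le_trans by blast
    then show False using free by simp
  qed
  have light: "card (sep ?E S T) < t" if ST: "card S = k - 1" "card T = k" "sep ?E T S \<noteq> {}" for S T
  proof (rule ccontr)
    assume "\<not> ?thesis"
    then have many: "t \<le> card (sep ?E S T)" by simp
    then have "sep ?E S T \<noteq> {}" using t by auto
    then obtain A0 where A0: "A0 \<in> ?E" "S \<subseteq> A0" unfolding sep_def by blast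
    then have S: "S \<subseteq> {..<i}" using sub by blast
    then have S': "card (insert i S) = k" using ST(1) k finite_subset[OF S] by (subst card_insert_disjoint) auto
    obtain B where B: "B \<in> ?E" "T \<subseteq> B" "B \<inter> S = {}" using ST(3) unfolding sep_def by blast
    have T: "T \<subseteq> {..<i}" using B sub by blast
    \<comment> \<open>One member from the child containing \<open>i\<close> is chosen for each
      \<open>A\<close>. Its trace below \<open>i\<close> gives \<open>A\<close> back, so distinct
      forks yield distinct members.\<close>
    have "\<forall>A\<in>sep ?E S T. \<exists>C. C \<in> with_trace \<F> (Suc i) (insert i A)"
      unfolding sep_def branch1_def by blast
    then obtain g where g: "\<And>A. A \<in> sep ?E S T \<Longrightarrow> g A \<in> with_trace \<F> (Suc i) (insert i A)"
      using bchoice[of "sep ?E S T" "\<lambda>A C. C \<in> with_trace \<F> (Suc i) (insert i A)"] by blast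
    have "g A \<inter> {..<i} = A" if "A \<in> sep ?E S T" for A
    proof -
      have "g A \<inter> {..<Suc i} = insert i A" using g[OF that] by (simp add: with_trace_def)
      moreover have "A \<subseteq> {..<i}" using that sub by (auto simp: sep_def)
      ultimately show ?thesis by (auto simp: lessThan_Suc)
    qed
    then have "inj_on g (sep ?E S T)" by (metis inj_onI)
    moreover have "g ` sep ?E S T \<subseteq> sep \<F> (insert i S) T"
    proof
      fix C assume "C \<in> g ` sep ?E S T"
      then obtain A where A: "A \<in> sep ?E S T" "C = g A" by blast
      have "with_trace \<F> (Suc i) (insert i A) \<subseteq> sep \<F> (insert i S) T"
        using A T by (intro with_trace_subset_sep) (auto simp: sep_def)
      then show "C \<in> sep \<F> (insert i S) T" using g A by blast
    qed
    ultimately have "card (sep ?E S T) \<le> card (sep \<F> (insert i S) T)"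
      using fin_sep by (intro card_inj_on_le[of g])
    then have 1: "t \<le> card (sep \<F> (insert i S) T)" using many by simp
    \<comment> \<open>The heavy child of the fork \<open>B\<close> consists of members missing
      \<open>i\<close>, so all of them avoid \<open>insert i S\<close>.\<close>
    have "with_trace \<F> (Suc i) B \<subseteq> sep \<F> T (insert i S)"
    proof (rule with_trace_subset_sep)
      show "T \<subseteq> B" by (rule B)
      show "insert i S \<inter> B = {}" using B sub by blast
      show "insert i S \<subseteq> {..<Suc i}" using S by auto
    qed
    then have "card (with_trace \<F> (Suc i) B) \<le> card (sep \<F> T (insert i S))"
      by (simp add: card_mono fin_sep)
    then have 2: "t \<le> card (sep \<F> T (insert i S))" using B(1) by (simp add: branch1_def)
    show False using free 1 2 S' ST(2) unfolding crossing_def by blast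
  qed
  have "card ?E \<le> (t * 2 ^ (2 * k - 1) + k + 1) * Suc (card {..<i}) ^ (k - 1)"
    using sub k cross light by (intro card_le_of_cross_light) auto
  then show ?thesis by simp
qed

text \<open>Complementing every member in \<open>{..<m}\<close> swaps the roles of \<open>S\<close>
  and \<open>T\<close>, under which \<open>crossing\<close> is symmetric, and swaps the two children
  of each fork. This reduces the claim to \<open>card_branch1_le\<close>.\<close>

lemma card_branch0_le:
  fixes \<F> :: "nat set set"
  assumes sub: "\<F> \<subseteq> Pow {..<m}" and free: "\<not> crossing t k \<F>" and t: "t \<ge> 1" and k: "k \<ge> 1" and i: "i < m"
  shows "card (branch0 t \<F> i) \<le> (t * 2 ^ (2 * k - 1) + k + 1) * Suc i ^ (k - 1)"
proof -
  define co where "co A = {..<m} - A" for A :: "nat set"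
  let ?G = "co ` \<F>"
  have fin: "finite \<F>" using sub by (meson finite_Pow_iff finite_lessThan finite_subset)
  have inj: "inj_on co (Pow {..<m})" by (rule inj_onI) (auto simp: co_def)
  have sep_co: "sep ?G S T = co ` sep \<F> T S" if "S \<subseteq> {..<m}" "T \<subseteq> {..<m}" for S T
    using that sub unfolding sep_def co_def by blast
  have card_co: "card (co ` \<A>) = card \<A>" if "\<A> \<subseteq> \<F>" for \<A>
    using that sub inj by (meson card_image inj_on_subset subset_trans)
  have "\<not> crossing t k ?G"
  proof
    assume "crossing t k ?G"
    then obtain S T where ST: "card S = k" "card T = k" "t \<le> card (sep ?G S T)" "t \<le> card (sep ?G T S)"
      unfolding crossing_def by blast
    have "sep ?G S T \<noteq> {}" "sep ?G T S \<noteq> {}" using ST t by auto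
    then have S: "S \<subseteq> {..<m}" and T: "T \<subseteq> {..<m}" by (auto simp: sep_def co_def)
    have "sep \<F> S T \<subseteq> \<F>" "sep \<F> T S \<subseteq> \<F>" by (auto simp: sep_def)
    then have "t \<le> card (sep \<F> T S)" "t \<le> card (sep \<F> S T)"
      using ST sep_co[OF S T] sep_co[OF T S] card_co by auto
    then show False using free ST unfolding crossing_def by blast
  qed
  then have bound: "card (branch1 t ?G i) \<le> (t * 2 ^ (2 * k - 1) + k + 1) * Suc i ^ (k - 1)"
    using fin t k by (intro card_branch1_le) auto
  let ?c = "\<lambda>P. {..<i} - P"
  have ext_co: "co ` with_trace \<F> (Suc i) Q = with_trace ?G (Suc i) ({..<Suc i} - Q)" if "Q \<subseteq> {..<Suc i}" for Q
  proof -
    have "A \<inter> {..<Suc i} = Q \<longleftrightarrow> co A \<inter> {..<Suc i} = {..<Suc i} - Q" for A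
      using that i by (fastforce simp: co_def)
    then show ?thesis by (auto simp: with_trace_def)
  qed
  have "?c ` branch0 t \<F> i \<subseteq> branch1 t ?G i"
  proof
    fix Q assume "Q \<in> ?c ` branch0 t \<F> i"
    then obtain P where P: "P \<subseteq> {..<i}" "t \<le> card (with_trace \<F> (Suc i) (insert i P))"
      "with_trace \<F> (Suc i) P \<noteq> {}" "Q = {..<i} - P" unfolding branch0_def by blast
    have "P \<subseteq> {..<Suc i}" using P(1) by auto
    \<comment> \<open>Complementing in \<open>{..<Suc i}\<close> turns the heavy child with
      \<open>i\<close> into the child of \<open>Q\<close> without \<open>i\<close>, and the nonempty
      child without \<open>i\<close> into the one with \<open>i\<close>.\<close>
    moreover have "{..<Suc i} - insert i P = Q" "{..<Suc i} - P = insert i Q" using P by auto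
    ultimately have "with_trace ?G (Suc i) Q = co ` with_trace \<F> (Suc i) (insert i P)"
      "with_trace ?G (Suc i) (insert i Q) = co ` with_trace \<F> (Suc i) P"
      using ext_co[of "insert i P"] ext_co[of P] by simp_all
    moreover have "with_trace \<F> (Suc i) (insert i P) \<subseteq> \<F>" by (auto simp: with_trace_def)
    ultimately show "Q \<in> branch1 t ?G i" using P card_co unfolding branch1_def by auto
  qed
  moreover have "finite (branch1 t ?G i)"
    by (rule finite_subset[of _ "Pow {..<i}"]) (auto simp: branch1_def)
  moreover have "inj_on ?c (branch0 t \<F> i)" by (rule inj_onI) (auto simp: branch0_def)
  ultimately have "card (branch0 t \<F> i) \<le> card (branch1 t ?G i)" by (intro card_inj_on_le[of ?c])
  then show ?thesis using bound by simp
qed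

text \<open>Each member is charged to a fork where its number of companions drops below
  \<open>2 * t\<close>. A fork receives at most \<open>4 * t\<close> members, and each of the
  \<open>m\<close> levels has at most \<open>2 * c * m ^ (k - 1)\<close> forks. The summand
  \<open>2 * t\<close> covers families too small for such a drop.\<close>

lemma card_crossing_free_le:
  fixes \<F> :: "nat set set"
  assumes sub: "\<F> \<subseteq> Pow {..<m}" and free: "\<not> crossing t k \<F>" and t: "t \<ge> 1" and k: "k \<ge> 1"
  shows "card \<F> \<le> 2 * t + 8 * t * (t * 2 ^ (2 * k - 1) + k + 1) * m ^ k"
proof (cases "card \<F> < 2 * t")
  case False
  define c where "c = t * 2 ^ (2 * k - 1) + k + 1"
  define N where "N i A = card (with_trace \<F> i (A \<inter> {..<i}))" for i A
  define M where "M i P = {A \<in> with_trace \<F> i P. N (Suc i) A < 2 * t}" for i P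
  define B where "B i = branch1 t \<F> i \<union> branch0 t \<F> i" for i
  have fin: "finite \<F>" using sub by (meson finite_Pow_iff finite_lessThan finite_subset)
  have fin_ext: "finite (with_trace \<F> i P)" for i P using fin by (simp add: with_trace_def)
  have finB: "finite (B i)" for i
    by (rule finite_subset[of _ "Pow {..<i}"]) (auto simp: B_def branch0_def branch1_def)
  have split: "A \<inter> {..<Suc i} = A \<inter> {..<i} \<or> A \<inter> {..<Suc i} = insert i (A \<inter> {..<i})" for A :: "nat set" and i
    by (auto simp: lessThan_Suc)
  have cov: "\<F> \<subseteq> (\<Union>i<m. \<Union>P\<in>B i. M i P)"
  proof
    fix A assume A: "A \<in> \<F>"
    \<comment> \<open>At level \<open>m\<close> the trace determines the member, at level 0 every
      member shares the empty trace; so the count drops below \<open>2 * t\<close> somewhere in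
      between.\<close>
    have "with_trace \<F> m (A \<inter> {..<m}) = {A}" using A sub by (auto simp: with_trace_def)
    then have "N m A < 2 * t" using t by (simp add: N_def)
    moreover have "\<not> N 0 A < 2 * t" using False by (simp add: N_def with_trace_def)
    ultimately obtain i where i: "i < m" "\<not> N i A < 2 * t" "N (Suc i) A < 2 * t"
      using ex_least_nat_less[of "\<lambda>i. N i A < 2 * t" m] by blast
    define P where "P = A \<inter> {..<i}"
    let ?E0 = "with_trace \<F> (Suc i) P" and ?E1 = "with_trace \<F> (Suc i) (insert i P)"
    have "with_trace \<F> i P \<subseteq> ?E0 \<union> ?E1" using split unfolding with_trace_def by blast
    then have "card (with_trace \<F> i P) \<le> card (?E0 \<union> ?E1)" by (simp add: card_mono fin_ext)
    also have "\<dots> \<le> card ?E0 + card ?E1" by (rule card_Un_le)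
    finally have sum: "2 * t \<le> card ?E0 + card ?E1" using i(2) by (simp add: N_def P_def)
    have "A \<in> ?E0 \<or> A \<in> ?E1"
      using split[of A i] A unfolding with_trace_def P_def by blast
    moreover have "card ?E0 < 2 * t" if "A \<in> ?E0" using that i(3) by (simp add: N_def with_trace_def)
    moreover have "card ?E1 < 2 * t" if "A \<in> ?E1" using that i(3) by (simp add: N_def with_trace_def)
    \<comment> \<open>The child containing \<open>A\<close> has fewer than \<open>2 * t\<close>
      members, so it cannot reach the sum alone and the other child is nonempty too.\<close>
    ultimately have "?E0 \<noteq> {} \<and> ?E1 \<noteq> {}" using sum by fastforce
    moreover have "t \<le> card ?E0 \<or> t \<le> card ?E1" using sum by linarith
    moreover have "P \<subseteq> {..<i}" by (simp add: P_def)
    ultimately have "P \<in> B i" unfolding B_def branch0_def branch1_def by blast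
    moreover have "A \<in> M i P" using A i(3) by (simp add: M_def with_trace_def P_def)
    ultimately show "A \<in> (\<Union>i<m. \<Union>P\<in>B i. M i P)" using i(1) by blast
  qed
  have cardM: "card (M i P) \<le> 4 * t" for i P
  proof -
    \<comment> \<open>A child counts only if it is small; a large child contributes the empty
      set.\<close>
    define U where "U Q = {A \<in> with_trace \<F> (Suc i) Q. card (with_trace \<F> (Suc i) Q) < 2 * t}" for Q
    have U: "card (U Q) \<le> 2 * t" for Q
    proof (cases "card (with_trace \<F> (Suc i) Q) < 2 * t")
      case True
      then show ?thesis by (simp add: U_def)
    qed (simp add: U_def)
    have "M i P \<subseteq> U P \<union> U (insert i P)"
    proof
      fix A assume A: "A \<in> M i P"
      then have "A \<inter> {..<Suc i} \<in> {P, insert i P}"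
        using split[of A i] by (simp add: M_def with_trace_def)
      moreover have "A \<in> U (A \<inter> {..<Suc i})"
        using A by (simp add: M_def U_def N_def with_trace_def)
      ultimately show "A \<in> U P \<union> U (insert i P)" by (metis UnCI insertE singletonD)
    qed
    then have "card (M i P) \<le> card (U P \<union> U (insert i P))"
      by (intro card_mono) (auto simp: U_def fin_ext)
    also have "\<dots> \<le> card (U P) + card (U (insert i P))" by (rule card_Un_le)
    finally show ?thesis using U[of P] U[of "insert i P"] by linarith
  qed
  have cardB: "card (B i) \<le> 2 * c * m ^ (k - 1)" if "i < m" for i
  proof -
    have "card (B i) \<le> card (branch1 t \<F> i) + card (branch0 t \<F> i)"
      unfolding B_def by (rule card_Un_le)
    also have "\<dots> \<le> c * Suc i ^ (k - 1) + c * Suc i ^ (k - 1)"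
      unfolding c_def
      by (intro add_mono card_branch1_le[OF fin free t k] card_branch0_le[OF sub free t k that])
    also have "\<dots> = 2 * c * Suc i ^ (k - 1)" by simp
    also have "\<dots> \<le> 2 * c * m ^ (k - 1)"
      using that by (intro mult_left_mono power_mono) auto
    finally show ?thesis .
  qed
  have finM: "finite (M i P)" for i P using fin_ext by (simp add: M_def)
  have "card \<F> \<le> card (\<Union>i<m. \<Union>P\<in>B i. M i P)"
    using cov finB finM by (intro card_mono) auto
  also have "\<dots> \<le> (\<Sum>i<m. card (\<Union>P\<in>B i. M i P))" by (rule card_UN_le) simp
  also have "\<dots> \<le> (\<Sum>i<m. 2 * c * m ^ (k - 1) * (4 * t))"
  proof (rule sum_mono)
    fix i assume "i \<in> {..<m}"
    have "card (\<Union>P\<in>B i. M i P) \<le> (\<Sum>P\<in>B i. card (M i P))" by (rule card_UN_le[OF finB])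
    also have "\<dots> \<le> (\<Sum>P\<in>B i. 4 * t)" by (rule sum_mono[OF cardM])
    also have "\<dots> = card (B i) * (4 * t)" by simp
    also have "\<dots> \<le> 2 * c * m ^ (k - 1) * (4 * t)"
      using cardB \<open>i \<in> {..<m}\<close> by (intro mult_right_mono) auto
    finally show "card (\<Union>P\<in>B i. M i P) \<le> 2 * c * m ^ (k - 1) * (4 * t)" .
  qed
  also have "\<dots> = 8 * t * c * (m * m ^ (k - 1))" by simp
  also have "m * m ^ (k - 1) = m ^ k" using k by (cases k) auto
  finally show ?thesis unfolding c_def by simp
qed simp

section \<open>Configurations as crossing pairs\<close>

lemma bij_betw_pick:
  assumes "finite I"
  shows "bij_betw (pick I) {..<card I} I"
proof -
  have "inj_on (pick I) {..<card I}"
    by (intro inj_onI) (metis lessThan_iff nat_neq_iff pick_mono_le)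
  moreover have "pick I ` {..<card I} \<subseteq> I" using pick_in_set_le by auto
  moreover have "card (pick I ` {..<card I}) = card I"
    using calculation(1) by (simp add: card_image)
  ultimately show ?thesis using assms by (simp add: bij_betw_def card_subset_eq)
qed

text \<open>\<open>submatrix\<close> lists the chosen indices in increasing order through
  \<open>pick\<close>; the permutation \<open>p\<close> records how \<open>r\<close> deviates from
  that order.\<close>

lemma ex_permutes_pick:
  assumes "inj_on r {..<n}"
  obtains p where "p permutes {..<n}" "\<And>i. i < n \<Longrightarrow> pick (r ` {..<n}) i = r (p i)"
proof -
  let ?I = "r ` {..<n}"
  define p where "p i = (if i < n then inv_into {..<n} r (pick ?I i) else i)" for i
  have "card ?I = n" using assms by (simp add: card_image)
  then have pick: "bij_betw (pick ?I) {..<n} ?I" using bij_betw_pick[of ?I] by simp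
  have "bij_betw (inv_into {..<n} r) ?I {..<n}"
    by (rule bij_betw_inv_into) (simp add: assms bij_betw_imageI)
  then have "bij_betw (inv_into {..<n} r \<circ> pick ?I) {..<n} {..<n}"
    using pick by (rule bij_betw_trans[rotated])
  then have "bij_betw p {..<n} {..<n}"
    by (rule bij_betw_cong[THEN iffD1, rotated]) (simp add: p_def)
  then have "p permutes {..<n}" by (rule bij_imp_permutes) (simp add: p_def)
  moreover have "pick ?I i = r (p i)" if "i < n" for i
  proof -
    have "pick ?I i \<in> ?I" using pick that by (auto simp: bij_betw_def)
    then show ?thesis using that by (simp add: p_def f_inv_into_f)
  qed
  ultimately show ?thesis by (rule that)
qed

text \<open>Choosing an index set and permuting it amounts to choosing an injection. Forwards,
  \<open>pick\<close> is composed with the inverse permutation; backwards, the index sets are the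
  images and \<open>ex_permutes_pick\<close> supplies the permutations.\<close>

lemma configuration_in_iff_inj:
  "configuration_in F A \<longleftrightarrow>
     (\<exists>r c. inj_on r {..<dim_row F} \<and> r ` {..<dim_row F} \<subseteq> {..<dim_row A} \<and>
        inj_on c {..<dim_col F} \<and> c ` {..<dim_col F} \<subseteq> {..<dim_col A} \<and>
        (\<forall>i<dim_row F. \<forall>j<dim_col F. F $$ (i, j) = A $$ (r i, c j)))" (is "?L \<longleftrightarrow> ?R")
proof
  assume ?L
  then obtain p q I J where p: "p permutes {..<dim_row F}" and q: "q permutes {..<dim_col F}"
    and I: "I \<subseteq> {..<dim_row A}" and J: "J \<subseteq> {..<dim_col A}"
    and eq: "mat (dim_row F) (dim_col F) (\<lambda>(i, j). F $$ (p i, q j)) = submatrix A I J"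
    unfolding configuration_in_def by blast
  have set: "{i. i < dim_row A \<and> i \<in> I} = I" "{j. j < dim_col A \<and> j \<in> J} = J" using I J by auto
  have dim: "card I = dim_row F" "card J = dim_col F"
    using arg_cong[OF eq, of dim_row] arg_cong[OF eq, of dim_col] by (simp_all add: dim_submatrix set)
  have fin: "finite I" "finite J" using I J finite_subset by blast+
  have r: "bij_betw (pick I \<circ> inv_into UNIV p) {..<dim_row F} I"
    using permutes_imp_bij[OF permutes_inv[OF p]] bij_betw_pick[OF fin(1)]
    by (auto simp: dim intro: bij_betw_trans)
  have c: "bij_betw (pick J \<circ> inv_into UNIV q) {..<dim_col F} J"
    using permutes_imp_bij[OF permutes_inv[OF q]] bij_betw_pick[OF fin(2)]
    by (auto simp: dim intro: bij_betw_trans)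
  have "F $$ (i, j) = A $$ ((pick I \<circ> inv_into UNIV p) i, (pick J \<circ> inv_into UNIV q) j)"
    if "i < dim_row F" "j < dim_col F" for i j
  proof -
    have ij: "inv_into UNIV p i < dim_row F" "inv_into UNIV q j < dim_col F"
      using that permutes_in_image[OF permutes_inv[OF p], of i] permutes_in_image[OF permutes_inv[OF q], of j] by auto
    have "F $$ (p (inv_into UNIV p i), q (inv_into UNIV q j)) = submatrix A I J $$ (inv_into UNIV p i, inv_into UNIV q j)"
      using ij by (simp flip: eq)
    also have "\<dots> = A $$ (pick I (inv_into UNIV p i), pick J (inv_into UNIV q j))"
      using ij by (intro submatrix_index) (simp_all add: set dim)
    finally show ?thesis by (simp add: permutes_inverses[OF p] permutes_inverses[OF q])
  qed
  then show ?R using r c I J unfolding bij_betw_def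
    by (intro exI[of _ "pick I \<circ> inv_into UNIV p"] exI[of _ "pick J \<circ> inv_into UNIV q"]) simp
next
  assume ?R
  then obtain r c where r: "inj_on r {..<dim_row F}" "r ` {..<dim_row F} \<subseteq> {..<dim_row A}"
    and c: "inj_on c {..<dim_col F}" "c ` {..<dim_col F} \<subseteq> {..<dim_col A}"
    and eq: "\<And>i j. i < dim_row F \<Longrightarrow> j < dim_col F \<Longrightarrow> F $$ (i, j) = A $$ (r i, c j)"
    by (elim exE conjE) (rule that; (assumption | simp))
  let ?I = "r ` {..<dim_row F}" and ?J = "c ` {..<dim_col F}"
  obtain p where p: "p permutes {..<dim_row F}" "\<And>i. i < dim_row F \<Longrightarrow> pick ?I i = r (p i)"
    using ex_permutes_pick[OF r(1)] by blast
  obtain q where q: "q permutes {..<dim_col F}" "\<And>j. j < dim_col F \<Longrightarrow> pick ?J j = c (q j)"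
    using ex_permutes_pick[OF c(1)] by blast
  have set: "{i. i < dim_row A \<and> i \<in> ?I} = ?I" "{j. j < dim_col A \<and> j \<in> ?J} = ?J" using r c by auto
  have dim: "card ?I = dim_row F" "card ?J = dim_col F" using r c by (simp_all add: card_image)
  have "mat (dim_row F) (dim_col F) (\<lambda>(i, j). F $$ (p i, q j)) = submatrix A ?I ?J"
  proof (rule eq_matI)
    fix i j assume "i < dim_row (submatrix A ?I ?J)" "j < dim_col (submatrix A ?I ?J)"
    then have ij: "i < dim_row F" "j < dim_col F" by (simp_all only: dim_submatrix set dim)
    then have "p i < dim_row F" "q j < dim_col F"
      using permutes_in_image[OF p(1), of i] permutes_in_image[OF q(1), of j] by auto
    moreover have "submatrix A ?I ?J $$ (i, j) = A $$ (pick ?I i, pick ?J j)"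
      by (rule submatrix_index) (simp_all only: set dim ij)
    ultimately show "mat (dim_row F) (dim_col F) (\<lambda>(i, j). F $$ (p i, q j)) $$ (i, j) = submatrix A ?I ?J $$ (i, j)"
      using ij p q eq by simp
  qed (simp_all only: dim_submatrix set dim dim_row_mat dim_col_mat)
  then show ?L unfolding configuration_in_def using p q r c by blast
qed

lemma repeat_F_mat:
  shows "dim_row (repeat_mat t (F_mat 0 k k 0)) = 2 * k"
    and "dim_col (repeat_mat t (F_mat 0 k k 0)) = 2 * t"
    and "i < 2 * k \<Longrightarrow> j < 2 * t \<Longrightarrow>
      repeat_mat t (F_mat 0 k k 0) $$ (i, j) = (if i < k \<longleftrightarrow> even j then 1 else 0)"
proof -
  show "dim_row (repeat_mat t (F_mat 0 k k 0)) = 2 * k"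
    and "dim_col (repeat_mat t (F_mat 0 k k 0)) = 2 * t"
    by (simp_all add: repeat_mat_def F_mat_def mat_of_rows_list_def)
  assume "i < 2 * k" "j < 2 * t"
  then show "repeat_mat t (F_mat 0 k k 0) $$ (i, j) = (if i < k \<longleftrightarrow> even j then 1 else 0)"
    by (cases "even j")
      (auto simp: repeat_mat_def F_mat_def mat_of_rows_list_def nth_append even_iff_mod_2_eq_zero odd_iff_mod_2_eq_one)
qed

section \<open>The set family of the columns\<close>

definition col_sets :: "nat mat \<Rightarrow> nat set set" where
  "col_sets A = (\<lambda>j. {i. i < dim_row A \<and> A $$ (i, j) = 1}) ` {..<dim_col A}"

lemma simple_mat_entry:
  assumes "simple_mat A" "i < dim_row A" "j < dim_col A"
  shows "A $$ (i, j) = 0 \<or> A $$ (i, j) = 1"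
  using assms by (auto simp: simple_mat_def zero_one_mat_def)

lemma inj_on_col_sets:
  assumes "simple_mat A"
  shows "inj_on (\<lambda>j. {i. i < dim_row A \<and> A $$ (i, j) = 1}) {..<dim_col A}"
proof (rule inj_onI)
  fix j j' assume j: "j \<in> {..<dim_col A}" "j' \<in> {..<dim_col A}"
    and eq: "{i. i < dim_row A \<and> A $$ (i, j) = 1} = {i. i < dim_row A \<and> A $$ (i, j') = 1}"
  have "col A j = col A j'"
  proof (rule eq_vecI)
    fix i assume "i < dim_vec (col A j')"
    then have i: "i < dim_row A" by simp
    then have "A $$ (i, j) = 1 \<longleftrightarrow> A $$ (i, j') = 1" using eq by blast
    then have "A $$ (i, j) = A $$ (i, j')"
      using simple_mat_entry[OF assms i, of j] simple_mat_entry[OF assms i, of j'] j by auto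
    then show "col A j $ i = col A j' $ i" using i j by simp
  qed simp
  then have "cols A ! j = cols A ! j'" using j by simp
  then show "j = j'"
    using assms j by (simp add: simple_mat_def distinct_conv_nth) (metis cols_length)
qed

text \<open>The rows in \<open>S\<close> become the upper half and those in \<open>T\<close> the
  lower half. Columns from \<open>sep S T\<close> and \<open>sep T S\<close> alternate, matching the
  even and odd columns of the repeated matrix.\<close>

lemma configuration_in_if_crossing:
  assumes A: "simple_mat A" and cr: "crossing t k (col_sets A)" and t: "t \<ge> 1" and k: "k \<ge> 1"
  shows "configuration_in (repeat_mat t (F_mat 0 k k 0)) A"
proof -
  define s where "s j = {i. i < dim_row A \<and> A $$ (i, j) = 1}" for j
  have cs: "col_sets A = s ` {..<dim_col A}" by (simp add: col_sets_def s_def[abs_def])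
  obtain S T where ST: "card S = k" "card T = k"
    "t \<le> card (sep (col_sets A) S T)" "t \<le> card (sep (col_sets A) T S)"
    using cr unfolding crossing_def by blast
  have fin: "finite S" "finite T" using ST k by (auto intro: card_ge_0_finite)
  have "sep (col_sets A) S T \<noteq> {}" "sep (col_sets A) T S \<noteq> {}" using ST t by auto
  then have sub: "S \<subseteq> {..<dim_row A}" "T \<subseteq> {..<dim_row A}" and disj: "S \<inter> T = {}"
    by (auto simp: sep_def col_sets_def)
  obtain u where u: "u ` {..<k} \<subseteq> S" "inj_on u {..<k}"
    using card_le_inj[of "{..<k}" S] fin ST by auto
  obtain v where v: "v ` {..<k} \<subseteq> T" "inj_on v {..<k}"
    using card_le_inj[of "{..<k}" T] fin ST by auto
  have cols: "\<exists>f. f ` {..<t} \<subseteq> {j. j < dim_col A \<and> s j \<in> sep (col_sets A) P Q} \<and> inj_on f {..<t}"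
    if "t \<le> card (sep (col_sets A) P Q)" for P Q
  proof (rule card_le_inj)
    let ?J = "{j. j < dim_col A \<and> s j \<in> sep (col_sets A) P Q}"
    have "sep (col_sets A) P Q \<subseteq> s ` ?J" by (auto simp: cs sep_def)
    then have "card (sep (col_sets A) P Q) \<le> card ?J" by (intro surj_card_le) auto
    then show "card {..<t} \<le> card ?J" using that by simp
  qed auto
  obtain f where f: "f ` {..<t} \<subseteq> {j. j < dim_col A \<and> s j \<in> sep (col_sets A) S T}" "inj_on f {..<t}"
    using cols[OF ST(3)] by blast
  obtain g where g: "g ` {..<t} \<subseteq> {j. j < dim_col A \<and> s j \<in> sep (col_sets A) T S}" "inj_on g {..<t}"
    using cols[OF ST(4)] by blast
  define r where "r i = (if i < k then u i else v (i - k))" for i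
  define c where "c j = (if even j then f (j div 2) else g (j div 2))" for j
  have rS: "r i \<in> S" if "i < k" for i using u that by (auto simp: r_def)
  have rT: "r i \<in> T" if "\<not> i < k" "i < 2 * k" for i using v that by (auto simp: r_def)
  have cS: "c j < dim_col A" "S \<subseteq> s (c j)" "s (c j) \<inter> T = {}" if "even j" "j < 2 * t" for j
    using f(1) that by (auto simp: c_def sep_def image_subset_iff elim!: evenE)
  have cT: "c j < dim_col A" "T \<subseteq> s (c j)" "s (c j) \<inter> S = {}" if "odd j" "j < 2 * t" for j
    using g(1) that by (auto simp: c_def sep_def image_subset_iff elim!: oddE)
  have "inj_on r {..<2 * k}"
  proof (rule inj_onI)
    fix i j assume ij: "i \<in> {..<2 * k}" "j \<in> {..<2 * k}" "r i = r j"
    then have same: "i < k \<longleftrightarrow> j < k" using rS rT disj by (metis IntI emptyE lessThan_iff)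
    show "i = j"
    proof (cases "i < k")
      case True
      then show ?thesis using same ij u(2) by (simp add: r_def inj_on_def)
    next
      case False
      then have "i - k = j - k" using same ij v(2) by (simp add: r_def inj_on_def)
      then show ?thesis using False same by simp
    qed
  qed
  moreover have "inj_on c {..<2 * t}"
  proof (rule inj_onI)
    fix i j assume ij: "i \<in> {..<2 * t}" "j \<in> {..<2 * t}" "c i = c j"
    \<comment> \<open>The parity of \<open>j\<close> can be read off the column \<open>c j\<close>,
      because even columns contain the nonempty set \<open>S\<close> and odd ones avoid it.\<close>
    have "S \<noteq> {}" using ST k by auto
    then have same: "even i \<longleftrightarrow> even j" using cS cT ij by (metis Int_absorb2 Int_commute lessThan_iff)
    have "i div 2 < t" "j div 2 < t" using ij by auto
    then have "i div 2 = j div 2" using same ij f(2) g(2) by (auto simp: c_def inj_on_def split: if_splits)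
    then show "i = j" using same by (metis even_iff_mod_2_eq_zero odd_iff_mod_2_eq_one div_mod_decomp)
  qed
  moreover have "r ` {..<2 * k} \<subseteq> {..<dim_row A}" using rS rT sub by (auto; blast)
  moreover have "c ` {..<2 * t} \<subseteq> {..<dim_col A}" using cS(1) cT(1) by auto
  moreover have "repeat_mat t (F_mat 0 k k 0) $$ (i, j) = A $$ (r i, c j)" if ij: "i < 2 * k" "j < 2 * t" for i j
  proof -
    have "r i \<in> S \<union> T" "c j < dim_col A" using rS rT cS(1) cT(1) ij by blast+
    then have 01: "A $$ (r i, c j) = 0 \<or> A $$ (r i, c j) = 1"
      using simple_mat_entry[OF A] sub by blast
    have mem: "r i \<in> s (c j) \<longleftrightarrow> A $$ (r i, c j) = 1"
      using \<open>r i \<in> S \<union> T\<close> sub by (auto simp: s_def)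
    have "r i \<in> s (c j) \<longleftrightarrow> (i < k \<longleftrightarrow> even j)"
    proof (cases "even j")
      case True
      then show ?thesis using cS(2,3)[OF True ij(2)] rS[of i] rT[of i] ij(1) by auto
    next
      case False
      then show ?thesis using cT(2,3)[OF False ij(2)] rS[of i] rT[of i] ij(1) by auto
    qed
    then show ?thesis using 01 mem repeat_F_mat(3)[OF ij] by auto
  qed
  ultimately show ?thesis unfolding configuration_in_iff_inj repeat_F_mat(1,2) by blast
qed

section \<open>Upper and lower bounds on \<open>forb\<close>\<close>

lemma forb_repeat_F_mat_le:
  assumes t: "t \<ge> 1" and k: "k \<ge> 1"
  shows "forb m {repeat_mat t (F_mat 0 k k 0)} \<le> 2 * t + 8 * t * (t * 2 ^ (2 * k - 1) + k + 1) * m ^ k"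
proof -
  let ?F = "{repeat_mat t (F_mat 0 k k 0)}"
  have "forb m ?F \<in> forb_col_counts m ?F"
    unfolding forb_def using t
    by (intro Max_in finite_forb_col_counts forb_col_counts_nonempty) (auto simp: repeat_F_mat)
  then obtain A where A: "simple_mat A" "dim_row A = m" "\<not> configuration_in (repeat_mat t (F_mat 0 k k 0)) A"
    "forb m ?F = dim_col A" unfolding forb_col_counts_def by auto
  have "card (col_sets A) = dim_col A"
    unfolding col_sets_def using inj_on_col_sets[OF A(1)] by (simp add: card_image)
  moreover have "\<not> crossing t k (col_sets A)" using configuration_in_if_crossing[OF A(1) _ t k] A(3) by blast
  moreover have "col_sets A \<subseteq> Pow {..<m}" using A(2) by (auto simp: col_sets_def)
  ultimately show ?thesis using card_crossing_free_le[OF _ _ t k] A(4) by metis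
qed

text \<open>The \<open>k\<close>-element subsets attain the lower bound: a \<open>k\<close>-set of rows lies in only one of them.\<close>

lemma choose_le_forb_repeat_F_mat:
  assumes t: "t \<ge> 2" and k: "k \<ge> 1"
  shows "m choose k \<le> forb m {repeat_mat t (F_mat 0 k k 0)}"
proof -
  let ?F = "repeat_mat t (F_mat 0 k k 0)"
  define \<K> where "\<K> = {B. B \<subseteq> {..<m} \<and> card B = k}"
  have "finite \<K>" by (simp add: \<K>_def)
  then obtain xs where xs: "set xs = \<K>" "distinct xs" using finite_distinct_list by blast
  define A where "A = mat m (length xs) (\<lambda>(i, j). of_bool (i \<in> xs ! j) :: nat)"
  have dim: "dim_row A = m" "dim_col A = length xs" by (simp_all add: A_def)
  have xs_sub: "xs ! j \<subseteq> {..<m}" "card (xs ! j) = k" if "j < length xs" for j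
    using nth_mem[OF that] xs by (auto simp: \<K>_def)
  have "distinct (cols A)"
    unfolding distinct_conv_nth
  proof (intro allI impI notI)
    fix i j assume ij: "i < length (cols A)" "j < length (cols A)" "i \<noteq> j" and eq: "cols A ! i = cols A ! j"
    then have len: "i < length xs" "j < length xs" by (simp_all add: dim)
    have "l \<in> xs ! i \<longleftrightarrow> l \<in> xs ! j" if "l < m" for l
    proof -
      have "col A i $ l = col A j $ l" using eq len by (simp add: dim)
      then show ?thesis using that len by (simp add: A_def of_bool_eq_iff)
    qed
    then have "xs ! i = xs ! j" using xs_sub len by blast
    then show False using xs(2) ij(3) len by (simp add: distinct_conv_nth)
  qed
  then have "simple_mat A"
    by (auto simp: simple_mat_def zero_one_mat_def elements_mat_def A_def)
  moreover have "\<not> configuration_in ?F A"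
  proof
    assume "configuration_in ?F A"
    then obtain r c where r: "inj_on r {..<2 * k}" "r ` {..<2 * k} \<subseteq> {..<m}"
      and c: "inj_on c {..<2 * t}" "c ` {..<2 * t} \<subseteq> {..<length xs}"
      and eq: "\<And>i j. i < 2 * k \<Longrightarrow> j < 2 * t \<Longrightarrow> ?F $$ (i, j) = A $$ (r i, c j)"
      unfolding configuration_in_iff_inj repeat_F_mat(1,2) dim 
      by (elim exE conjE) (rule that; (assumption | simp))
    \<comment> \<open>An even column has ones in the first \<open>k\<close> rows of the
      configuration, and these already exhaust its \<open>k\<close> elements.\<close>
    have "xs ! c j = r ` {..<k}" if "even j" "j < 2 * t" for j
    proof -
      have len: "c j < length xs" using c(2) that(2) by auto
      have "r ` {..<k} \<subseteq> xs ! c j"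
      proof
        fix x assume "x \<in> r ` {..<k}"
        then obtain i where i: "i < k" "x = r i" by auto
        then have "A $$ (r i, c j) = 1" using eq[of i j] repeat_F_mat(3)[of i k j t] that by simp
        moreover have "r i < m" using r(2) i by (simp add: image_subset_iff)
        ultimately show "x \<in> xs ! c j" using i len by (simp add: A_def of_bool_def split: if_splits)
      qed
      moreover have "card (r ` {..<k}) = k"
        using inj_on_subset[OF r(1), of "{..<k}"] by (simp add: card_image)
      ultimately show ?thesis
        using xs_sub[OF len] finite_subset[of "xs ! c j" "{..<m}"] by (metis card_subset_eq finite_lessThan)
    qed
    \<comment> \<open>Columns 0 and 2 are two copies of the same column; both exist because
      \<open>t \<ge> 2\<close>.\<close>
    from this[of 0] this[of 2] have "xs ! c 0 = xs ! c 2" using t by simp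
    moreover have "c 0 < length xs" "c 2 < length xs" using c(2) t by (simp_all add: image_subset_iff)
    ultimately have "c 0 = c 2" using xs(2) by (simp add: nth_eq_iff_index_eq)
    then show False using inj_onD[OF c(1), of 0 2] t by simp
  qed
  ultimately have "dim_col A \<in> forb_col_counts m {?F}"
    unfolding forb_col_counts_def using dim(1) by blast
  then have "length xs \<le> forb m {?F}"
    unfolding forb_def dim(2) by (intro Max_ge finite_forb_col_counts)
  moreover have "length xs = m choose k"
    using distinct_card[OF xs(2)] xs(1) n_subsets[of "{..<m}" k] by (simp add: \<K>_def)
  ultimately show ?thesis by simp
qed

theorem theorem1:
  fixes t k :: nat
  assumes "t \<ge> 2" and "k \<ge> 1"
  shows "(\<lambda>m. real (forb m {repeat_mat t (F_mat 0 k k 0)})) \<in> \<Theta>(\<lambda>m. real m ^ k)"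
proof (rule bigthetaI')
  let ?c = "2 * t + 8 * t * (t * 2 ^ (2 * k - 1) + k + 1)"
  show "1 / real k ^ k > 0" using assms by simp
  show "real ?c > 0" using assms by (simp only: of_nat_0_less_iff)
  show "\<forall>\<^sub>F m in at_top.
      1 / real k ^ k * norm (real m ^ k) \<le> norm (real (forb m {repeat_mat t (F_mat 0 k k 0)})) \<and>
      norm (real (forb m {repeat_mat t (F_mat 0 k k 0)})) \<le> real ?c * norm (real m ^ k)"
    using eventually_ge_at_top[of k]
  proof eventually_elim
    case (elim m)
    let ?f = "forb m {repeat_mat t (F_mat 0 k k 0)}"
    have "1 / real k ^ k * real m ^ k = (real m / real k) ^ k" by (simp add: power_divide)
    also have "\<dots> \<le> real (m choose k)" by (rule binomial_ge_n_over_k_pow_k[OF elim])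
    also have "\<dots> \<le> real ?f" using choose_le_forb_repeat_F_mat[OF assms] by simp
    finally have lower: "1 / real k ^ k * real m ^ k \<le> real ?f" .
    have "?f \<le> 2 * t * 1 + 8 * t * (t * 2 ^ (2 * k - 1) + k + 1) * m ^ k"
      using forb_repeat_F_mat_le[of t k m] assms by simp
    \<comment> \<open>Here \<open>m \<ge> k \<ge> 1\<close> gives \<open>m ^ k \<ge> 1\<close>,
      which absorbs the additive \<open>2 * t\<close> into the constant.\<close>
    also have "\<dots> \<le> 2 * t * m ^ k + 8 * t * (t * 2 ^ (2 * k - 1) + k + 1) * m ^ k"
      using elim assms by (intro add_right_mono mult_left_mono) auto
    also have "\<dots> = ?c * m ^ k" by (simp only: add_mult_distrib)
    finally have "real ?f \<le> real (?c * m ^ k)" by (simp only: of_nat_le_iff)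
    then have "real ?f \<le> real ?c * real m ^ k" by (simp only: of_nat_mult of_nat_power)
    then show ?case using lower by (simp only: norm_of_nat norm_power)
  qed
qed

end
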